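(* Let $1\le m<n$ be integers, let $\mu$ be a measure on $\mathbb{R}$ with finite moments such that $H_k[\mu]\neq0$ for $1\le k\le n-m$, let $A=(a_{jk})_{j,k=1}^m$ be an $m\times m$ matrix, and let $x_1,\dots,x_m$ and $y_1,\dots,y_m$ be variables. Define the $n\times n$ determinant $$H_n^F[\mu;x_1,\dots,x_m;y_1,\dots,y_m;A]:=\det\begin{pmatrix}\mu_0&\mu_1&\cdots&\mu_{n-m-1}&1&\cdots&1\\ \mu_1&\mu_2&\cdots&\mu_{n-m}&x_1&\cdots&x_m\\ \vdots&\vdots&\ddots&\vdots&\vdots&\ddots&\vdots\\ \mu_{n-m-1}&\mu_{n-m}&\cdots&\mu_{2(n-m-1)}&x_1^{n-m-1}&\cdots&x_m^{n-m-1}\\ 1&y_1&\cdots&y_1^{n-m-1}&a_{11}&\cdots&a_{1m}\\ \vdots&\vdots&\ddots&\vdots&\vdots&\ddots&\vdots\\ 1&y_m&\cdots&y_m^{n-m-1}&a_{m1}&\cdots&a_{mm}\end{pmatrix}.$$ Then $$H_n^F[\mu;x_1,\dots,x_m;y_1,\dots,y_m;A]=H_{n-m}[\mu]\,\det\left[A-\left(K_{n-m-1}(x_k,y_j)\right)_{j,k=1}^m\right].$$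
   Context: $\mu_k=\int_{\mathbb{R}}x^k\,\mathrm{d}\mu(x)$ is the $k$th moment of $\mu$ and $H_k[\mu]=\det(\mu_{i+j})_{0\le i,j\le k-1}$. $P_k$ denotes the monic orthogonal polynomial of degree $k$ with respect to $\mu$: $\int_{\mathbb{R}}P_k(x)P_j(x)\,\mathrm{d}\mu(x)=h_k\delta_{jk}$. The reproducing kernel is $K_n(x,y)=\sum_{k=0}^n\frac{P_k(x)P_k(y)}{h_k}$. *)

theory Defs
  imports "HOL-Analysis.Bochner_Integration" "Jordan_Normal_Form.Determinant"
begin

definition moment :: "real measure \<Rightarrow> nat \<Rightarrow> real" where
  "moment M k = (\<integral>x. x ^ k \<partial>M)"

definition hankel_mat :: "real measure \<Rightarrow> nat \<Rightarrow> real Matrix.mat" where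
  "hankel_mat M k = Matrix.mat k k (\<lambda>(i, j). moment M (i + j))"

definition hankel_det :: "real measure \<Rightarrow> nat \<Rightarrow> real" where
  "hankel_det M k = Determinant.det (hankel_mat M k)"

definition poly_inner :: "real measure \<Rightarrow> real poly \<Rightarrow> real poly \<Rightarrow> real" where
  "poly_inner M p q = (\<integral>x. poly p x * poly q x \<partial>M)"

text \<open>
  The monic orthogonal polynomial \<open>P\<^sub>k\<close> of degree \<open>k\<close>. Since \<open>poly_inner\<close> is symmetric, requiring
  orthogonality to the earlier \<open>P\<^sub>j\<close> for all \<open>k\<close> amounts to \<open>\<integral> P\<^sub>k P\<^sub>j d\<mu> = h\<^sub>k \<delta>\<^sub>j\<^sub>k\<close>. The definite
  description denotes whenever the moments are finite and the Hankel determinants of sizes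
  \<open>1, \<dots>, k\<close> do not vanish; otherwise the value is unspecified.
\<close>

function orth_poly :: "real measure \<Rightarrow> nat \<Rightarrow> real poly" where
  "orth_poly M k = (THE p. degree p = k \<and> lead_coeff p = 1 \<and>
     (\<forall>j\<in>{..<k}. poly_inner M p (orth_poly M j) = 0))"
  by auto
termination by (relation "Wellfounded.measure snd") auto

declare orth_poly.simps [simp del]

definition orth_norm :: "real measure \<Rightarrow> nat \<Rightarrow> real" where
  "orth_norm M k = poly_inner M (orth_poly M k) (orth_poly M k)"

text \<open>
  The variables and the entries of \<open>A\<close> range over an arbitrary field extension \<open>'a\<close> of the reals
  (such as the reals or the complex numbers); real data are embedded by \<open>of_real\<close>.
\<close>

definition repr_kernel :: "real measure \<Rightarrow> nat \<Rightarrow> 'a::real_field \<Rightarrow> 'a \<Rightarrow> 'a" where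
  "repr_kernel M n x y = (\<Sum>k\<le>n.
     poly (map_poly of_real (orth_poly M k)) x * poly (map_poly of_real (orth_poly M k)) y
       / of_real (orth_norm M k))"

text \<open>
  The families \<open>x\<^sub>1, \<dots>, x\<^sub>m\<close> and \<open>y\<^sub>1, \<dots>, y\<^sub>m\<close> are indexed from 0, like the rows and columns of
  matrices: \<open>x k\<close> and \<open>y k\<close> are used for \<open>k < m\<close> only.
\<close>

definition bordered_hankel_mat ::
  "real measure \<Rightarrow> nat \<Rightarrow> nat \<Rightarrow> (nat \<Rightarrow> 'a::real_field) \<Rightarrow> (nat \<Rightarrow> 'a) \<Rightarrow> 'a Matrix.mat \<Rightarrow> 'a Matrix.mat"
  where
  "bordered_hankel_mat M n m x y A =
     four_block_mat
       (map_mat of_real (hankel_mat M (n - m)))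
       (Matrix.mat (n - m) m (\<lambda>(i, k). x k ^ i))
       (Matrix.mat m (n - m) (\<lambda>(j, i). y j ^ i))
       A"

definition bordered_hankel_det ::
  "real measure \<Rightarrow> nat \<Rightarrow> nat \<Rightarrow> (nat \<Rightarrow> 'a::real_field) \<Rightarrow> (nat \<Rightarrow> 'a) \<Rightarrow> 'a Matrix.mat \<Rightarrow> 'a"
  where
  "bordered_hankel_det M n m x y A = Determinant.det (bordered_hankel_mat M n m x y A)"

end

theory Submission
  imports Defs
begin

text \<open>
  Let \<open>C\<close> be the lower unitriangular matrix of the coefficients of \<open>P\<^sub>0, \<dots>, P\<^sub>N\<^sub>-\<^sub>1\<close>, and \<open>H\<close> the Hankel
  matrix of size \<open>N\<close>. Orthogonality says \<open>C H C\<^sup>T = D\<close> with \<open>D = diag(h\<^sub>0, \<dots>, h\<^sub>N\<^sub>-\<^sub>1)\<close>. Hence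
  \<open>det H = h\<^sub>0 \<cdots> h\<^sub>N\<^sub>-\<^sub>1\<close>, so no \<open>h\<^sub>k\<close> vanishes and Gram--Schmidt applies, and moreover
  \<open>H\<^sup>-\<^sup>1 = C\<^sup>T D\<^sup>-\<^sup>1 C\<close> is the coefficient matrix of the reproducing kernel. The theorem is the Schur
  complement formula for the bordered matrix.
\<close>

section \<open>Schur complement of a block matrix\<close>

text \<open>Block elimination: left multiplication by the unitriangular \<open>?L\<close> subtracts
  \<open>Y * G\<close> times the upper block row from the lower one. This turns \<open>Y\<close>
  into \<open>0\<close> because \<open>G * H\<close> is the identity, and turns \<open>A\<close>
  into the Schur complement.\<close>

lemma det_four_block_schur:
  fixes H :: "'a::idom Matrix.mat"
  assumes H: "H \<in> carrier_mat n n" and G: "G \<in> carrier_mat n n" and GH: "G * H = 1\<^sub>m n"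
    and X: "X \<in> carrier_mat n m" and Y: "Y \<in> carrier_mat m n" and A: "A \<in> carrier_mat m m"
  shows "Determinant.det (four_block_mat H X Y A)
    = Determinant.det H * Determinant.det (A - Y * G * X)"
proof -
  let ?L = "four_block_mat (1\<^sub>m n) (0\<^sub>m n m) (- (Y * G)) (1\<^sub>m m)"
  have YG: "Y * G \<in> carrier_mat m n" and YGX: "Y * G * X \<in> carrier_mat m m"
    using assms by auto
  have "Y * G * H = Y"
    using assoc_mult_mat[OF Y G H] Y GH by simp
  moreover have "- (Y * G) * H = - (Y * G * H)" and "- (Y * G) * X = - (Y * G * X)"
    using YG H X by (auto simp del: assoc_mult_mat)
  moreover have "- Y + Y = 0\<^sub>m m n"
    using Y by (rule uminus_l_inv_mat)
  moreover have "- Z + A = A - Z" if "Z \<in> carrier_mat m m" for Z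
    using that A by (intro eq_matI) auto
  ultimately have "- (Y * G) * H + 1\<^sub>m m * Y = 0\<^sub>m m n"
    and "- (Y * G) * X + 1\<^sub>m m * A = A - Y * G * X"
    using Y A YGX by (simp_all only: left_mult_one_mat)
  moreover have "1\<^sub>m n * H + 0\<^sub>m n m * Y = H" "1\<^sub>m n * X + 0\<^sub>m n m * A = X"
    using H X Y A by simp_all
  ultimately have "?L * four_block_mat H X Y A = four_block_mat H X (0\<^sub>m m n) (A - Y * G * X)"
    using mult_four_block_mat[of "1\<^sub>m n" n n "0\<^sub>m n m" m "- (Y * G)" m "1\<^sub>m m" H n X m Y A]
      H X Y A YG by simp
  moreover have "Determinant.det ?L = 1"
    using det_four_block_mat_upper_right_zero[of "1\<^sub>m n" n "0\<^sub>m n m" m "- (Y * G)" "1\<^sub>m m"] YG by simp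
  moreover have "Determinant.det (?L * four_block_mat H X Y A)
      = Determinant.det ?L * Determinant.det (four_block_mat H X Y A)"
    using H X Y A YG by (intro det_mult[of _ "n + m"]) auto
  moreover have "Determinant.det (four_block_mat H X (0\<^sub>m m n) (A - Y * G * X))
      = Determinant.det H * Determinant.det (A - Y * G * X)"
    by (rule det_four_block_mat_lower_left_zero[OF H X refl minus_carrier_mat[OF YGX]])
  ultimately show ?thesis by simp
qed

section \<open>Monic families and their coefficient matrices\<close>

lemma poly_eq_sum_lessThan:
  fixes p :: "'a::comm_semiring_1 poly"
  assumes "degree p < n"
  shows "poly p x = (\<Sum>i<n. Polynomial.coeff p i * x ^ i)"
  unfolding poly_altdef using assms
  by (intro sum.mono_neutral_left) (auto simp: coeff_eq_0)

text \<open>Subtracting a multiple of the monic \<open>P k\<close> cancels the coefficient of index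
  \<open>k\<close>, and induction handles the rest. Bounding \<open>q\<close> by vanishing
  coefficients instead of its degree lets the base case say \<open>q = 0\<close>.\<close>

lemma monic_family_span:
  fixes P :: "nat \<Rightarrow> 'a::comm_ring_1 poly"
  assumes "\<And>j. j < k \<Longrightarrow> degree (P j) = j" and "\<And>j. j < k \<Longrightarrow> lead_coeff (P j) = 1"
    and "\<And>i. i \<ge> k \<Longrightarrow> Polynomial.coeff q i = 0"
  shows "\<exists>c. q = (\<Sum>j<k. smult (c j) (P j))"
  using assms
proof (induction k arbitrary: q)
  case 0
  then show ?case by (auto simp: poly_eq_iff)
next
  case (Suc k)
  let ?r = "q - smult (Polynomial.coeff q k) (P k)"
  have "Polynomial.coeff ?r i = 0" if "i \<ge> k" for i
  proof (cases "i = k")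
    case True
    then show ?thesis using Suc.prems(1)[of k] Suc.prems(2)[of k] by simp
  next
    case False
    then show ?thesis using that Suc.prems(1)[of k] Suc.prems(3)[of i] by (simp add: coeff_eq_0)
  qed
  then have "\<exists>c. ?r = (\<Sum>j<k. smult (c j) (P j))"
    by (intro Suc.IH Suc.prems(1,2)[OF less_SucI])
  then obtain c where c: "?r = (\<Sum>j<k. smult (c j) (P j))" ..
  have "q = (\<Sum>j<k. smult (c j) (P j)) + smult (Polynomial.coeff q k) (P k)"
    unfolding c[symmetric] by simp
  also have "\<dots> = (\<Sum>j<Suc k. smult ((c(k := Polynomial.coeff q k)) j) (P j))"
    by simp
  finally show ?case by blast
qed

text \<open>Coefficients of index \<open>n\<close> and above are cut off, so the rows determine the
  polynomials when all degrees are below \<open>n\<close>.\<close>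

definition coeff_mat :: "nat \<Rightarrow> (nat \<Rightarrow> real poly) \<Rightarrow> real Matrix.mat" where
  "coeff_mat n P = Matrix.mat n n (\<lambda>(k, i). Polynomial.coeff (P k) i)"

lemma det_coeff_mat:
  assumes "\<And>j. j < n \<Longrightarrow> degree (P j) = j" and "\<And>j. j < n \<Longrightarrow> lead_coeff (P j) = 1"
  shows "Determinant.det (coeff_mat n P) = 1"
proof -
  have "Determinant.det (coeff_mat n P) = prod_list (diag_mat (coeff_mat n P))"
    using assms by (intro det_lower_triangular[of n]) (auto simp: coeff_mat_def coeff_eq_0)
  also have "\<dots> = 1"
    unfolding prod_list_diag_prod
  proof (rule prod.neutral, safe)
    fix i assume "i \<in> {0..<dim_row (coeff_mat n P)}"
    hence "i < n" by (simp add: coeff_mat_def)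
    then show "coeff_mat n P $$ (i, i) = 1"
      using assms(1)[of i] assms(2)[of i] by (simp add: coeff_mat_def)
  qed
  finally show ?thesis .
qed

section \<open>The inner product and the Hankel matrix\<close>

lemma poly_inner_commute: "poly_inner M p q = poly_inner M q p"
  by (simp add: poly_inner_def mult.commute)

context
  fixes M :: "real measure"
  assumes moments: "\<And>k. integrable M (\<lambda>t. t ^ k)"
begin

lemma integrable_poly: "integrable M (poly p)"
  by (subst poly_altdef[abs_def]) (intro Bochner_Integration.integrable_sum integrable_mult_right moments)

lemma integrable_poly_mult: "integrable M (\<lambda>t. poly p t * poly q t)"
  using integrable_poly[of "p * q"] by (simp add: poly_mult[abs_def])

lemma poly_inner_diff_left: "poly_inner M (p - q) r = poly_inner M p r - poly_inner M q r"
  unfolding poly_inner_def by (simp add: left_diff_distrib integrable_poly_mult)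

lemma poly_inner_sum_smult_left:
  "poly_inner M (\<Sum>j\<in>J. smult (c j) (P j)) r = (\<Sum>j\<in>J. c j * poly_inner M (P j) r)"
proof -
  have "poly_inner M (\<Sum>j\<in>J. smult (c j) (P j)) r = (\<integral>t. (\<Sum>j\<in>J. c j * (poly (P j) t * poly r t)) \<partial>M)"
    unfolding poly_inner_def by (simp add: poly_sum sum_distrib_right mult.assoc)
  also have "\<dots> = (\<Sum>j\<in>J. c j * poly_inner M (P j) r)"
    unfolding poly_inner_def by (simp add: integrable_poly_mult)
  finally show ?thesis .
qed

text \<open>The bounds \<open>a\<close> and \<open>b\<close> need not be tight: padding with zero
  coefficients brings polynomials of different degrees to one matrix size.\<close>

lemma poly_inner_moments:
  assumes "degree p < a" "degree q < b"
  shows "poly_inner M p q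
    = (\<Sum>i<a. \<Sum>j<b. Polynomial.coeff p i * moment M (i + j) * Polynomial.coeff q j)"
proof -
  have "poly_inner M p q = (\<integral>t. (\<Sum>i<a. \<Sum>j<b.
      (Polynomial.coeff p i * Polynomial.coeff q j) * t ^ (i + j)) \<partial>M)"
    unfolding poly_inner_def poly_eq_sum_lessThan[OF assms(1)] poly_eq_sum_lessThan[OF assms(2)]
    by (simp add: sum_product power_add mult_ac)
  also have "\<dots> = (\<Sum>i<a. \<Sum>j<b. (Polynomial.coeff p i * Polynomial.coeff q j) * moment M (i + j))"
    unfolding moment_def using moments by simp
  finally show ?thesis by (simp add: mult_ac)
qed

text \<open>The Hankel matrix is the Gram matrix of the monomials, and the congruence passes to the
  Gram matrix of the family \<open>P\<close>.\<close>

lemma hankel_congruence: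
  assumes "\<And>j. j < n \<Longrightarrow> degree (P j) < n"
  shows "coeff_mat n P * hankel_mat M n * transpose_mat (coeff_mat n P)
    = Matrix.mat n n (\<lambda>(i, j). poly_inner M (P i) (P j))" (is "?l = ?r")
proof (rule eq_matI)
  fix i j assume "i < dim_row ?r" "j < dim_col ?r"
  hence i: "i < n" and j: "j < n" by simp_all
  have "?l $$ (i, j) = (\<Sum>b<n. (\<Sum>a<n. Polynomial.coeff (P i) a * moment M (a + b)) *
      Polynomial.coeff (P j) b)"
    using i j by (simp add: coeff_mat_def hankel_mat_def scalar_prod_def atLeast0LessThan)
  also have "\<dots> = (\<Sum>b<n. \<Sum>a<n. Polynomial.coeff (P i) a * moment M (a + b) * Polynomial.coeff (P j) b)"
    by (simp add: sum_distrib_right)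
  also have "\<dots> = poly_inner M (P i) (P j)"
    unfolding poly_inner_moments[OF assms[OF i] assms[OF j]] by (rule sum.swap)
  finally show "?l $$ (i, j) = ?r $$ (i, j)" using i j by simp
qed (auto simp: coeff_mat_def)

text \<open>Congruence by a unitriangular matrix preserves the determinant, and orthogonality makes
  the Gram matrix diagonal. The family is arbitrary, so that the formula is available during the
  inductive construction of the orthogonal polynomials.\<close>

lemma hankel_det_eq_prod:
  assumes deg: "\<And>j. j < n \<Longrightarrow> degree (P j) = j" and lc: "\<And>j. j < n \<Longrightarrow> lead_coeff (P j) = 1"
    and orth: "\<And>i j. i < n \<Longrightarrow> j < n \<Longrightarrow> i \<noteq> j \<Longrightarrow> poly_inner M (P i) (P j) = 0"
  shows "hankel_det M n = (\<Prod>j<n. poly_inner M (P j) (P j))"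
proof -
  let ?C = "coeff_mat n P" and ?D = "Matrix.mat n n (\<lambda>(i, j). poly_inner M (P i) (P j))"
  have C: "?C \<in> carrier_mat n n" and H: "hankel_mat M n \<in> carrier_mat n n"
    by (auto simp: coeff_mat_def hankel_mat_def)
  have "Determinant.det ?D = Determinant.det (?C * hankel_mat M n) * Determinant.det (transpose_mat ?C)"
    using C H deg by (subst hankel_congruence[symmetric]) (auto intro!: det_mult[of _ n] simp del: assoc_mult_mat)
  also have "\<dots> = hankel_det M n"
    using C H by (simp add: det_mult[OF C H] det_transpose[OF C] det_coeff_mat[OF deg lc] hankel_det_def)
  finally have "hankel_det M n = Determinant.det ?D" by simp
  also have "\<dots> = prod_list (diag_mat ?D)"
    using orth by (intro det_lower_triangular[of n]) auto
  also have "\<dots> = (\<Prod>j<n. poly_inner M (P j) (P j))"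
    by (simp add: prod_list_diag_prod atLeast0LessThan)
  finally show ?thesis .
qed

section \<open>Existence and uniqueness of the orthogonal polynomials\<close>

text \<open>A Gram-Schmidt step in which nonzero values \<open>poly_inner M (P j) (P j)\<close> take
  the place of positive definiteness.\<close>

lemma ex1_monic_orthogonal:
  assumes deg: "\<And>j. j < k \<Longrightarrow> degree (P j) = j" and lc: "\<And>j. j < k \<Longrightarrow> lead_coeff (P j) = 1"
    and orth: "\<And>i j. i < k \<Longrightarrow> j < k \<Longrightarrow> i \<noteq> j \<Longrightarrow> poly_inner M (P i) (P j) = 0"
    and nz: "\<And>j. j < k \<Longrightarrow> poly_inner M (P j) (P j) \<noteq> 0"
  shows "\<exists>!p. degree p = k \<and> lead_coeff p = 1 \<and> (\<forall>j\<in>{..<k}. poly_inner M p (P j) = 0)"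
proof -
  have expand: "poly_inner M (\<Sum>j<k. smult (c j) (P j)) (P i) = c i * poly_inner M (P i) (P i)"
    if "i < k" for c i
  proof -
    have "(\<Sum>j<k. c j * poly_inner M (P j) (P i))
        = (\<Sum>j<k. if j = i then c i * poly_inner M (P i) (P i) else 0)"
      using that orth by (intro sum.cong) auto
    then show ?thesis using that by (simp add: poly_inner_sum_smult_left)
  qed
  \<comment> \<open>These are the projection coefficients of the monomial of degree
    \<open>k\<close>; the witness is this monomial minus its projection \<open>s\<close>.\<close>
  define c where "c j = poly_inner M (monom 1 k) (P j) / poly_inner M (P j) (P j)" for j
  define s where "s = (\<Sum>j<k. smult (c j) (P j))"
  have s: "Polynomial.coeff s i = 0" if "i \<ge> k" for i
    unfolding s_def coeff_sum using that deg by (intro sum.neutral) (auto simp: coeff_eq_0)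
  show ?thesis
  proof (rule ex_ex1I, goal_cases)
    case 1
    have lead: "Polynomial.coeff (monom 1 k - s) k = 1" using s[of k] by simp
    have "degree (monom 1 k - s) \<le> k"
      by (rule degree_le) (use s in \<open>auto simp: coeff_eq_0\<close>)
    moreover have "k \<le> degree (monom 1 k - s)" by (rule le_degree) (use lead in simp)
    ultimately have "degree (monom 1 k - s) = k" by simp
    moreover have "poly_inner M (monom 1 k - s) (P j) = 0" if "j < k" for j
      using expand[OF that, of c] nz[OF that] by (simp add: poly_inner_diff_left s_def c_def)
    ultimately show ?case using lead by (intro exI[of _ "monom 1 k - s"]) auto
  next
    case (2 p q)
    \<comment> \<open>The leading terms of the two monic candidates cancel, so the difference lies
      in the span of the \<open>P j\<close> while being orthogonal to each of them.\<close>
    have "Polynomial.coeff (p - q) i = 0" if "i \<ge> k" for i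
      using that 2 by (cases "i = k") (auto simp: coeff_eq_0)
    then obtain d where d: "p - q = (\<Sum>j<k. smult (d j) (P j))"
      using monic_family_span[of k P "p - q"] deg lc by blast
    have "d j = 0" if "j < k" for j
    proof -
      have "poly_inner M (p - q) (P j) = 0" using 2 that by (simp add: poly_inner_diff_left)
      then show ?thesis using expand[OF that, of d] nz[OF that] d by simp
    qed
    then show "p = q" using d by simp
  qed
qed

text \<open>The definite description denotes only once the earlier norms are known to be nonzero. By
  strong induction their product is \<open>hankel_det M k\<close>, or the empty product if
  \<open>k = 0\<close>.\<close>

lemma orth_poly_props:
  assumes nz: "\<And>k. 1 \<le> k \<Longrightarrow> k \<le> N \<Longrightarrow> hankel_det M k \<noteq> 0" and "k \<le> N"
  shows "degree (orth_poly M k) = k \<and> lead_coeff (orth_poly M k) = 1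
    \<and> (\<forall>j<k. poly_inner M (orth_poly M k) (orth_poly M j) = 0)"
  using \<open>k \<le> N\<close>
proof (induction k rule: less_induct)
  case (less k)
  have deg: "degree (orth_poly M j) = j" and lc: "lead_coeff (orth_poly M j) = 1" if "j < k" for j
    using less.IH[OF that] less.prems that by auto
  have orth: "poly_inner M (orth_poly M i) (orth_poly M j) = 0" if "i < k" "j < k" "i \<noteq> j" for i j
    using less.IH[of i] less.IH[of j] less.prems that
      poly_inner_commute[of M "orth_poly M i" "orth_poly M j"]
    by (cases i j rule: linorder_cases) simp_all
  have "(\<Prod>j<k. poly_inner M (orth_poly M j) (orth_poly M j)) \<noteq> 0"
    using hankel_det_eq_prod[of k "orth_poly M", OF deg lc orth] nz[of k] less.prems
    by (cases "k = 0") auto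
  hence "poly_inner M (orth_poly M j) (orth_poly M j) \<noteq> 0" if "j < k" for j
    using that by auto
  from theI'[OF ex1_monic_orthogonal[of k "orth_poly M", OF deg lc orth this],
      folded orth_poly.simps[of M k]]
  show ?case by auto
qed

section \<open>The inverse Hankel matrix and the kernel\<close>

lemma hankel_inverse:
  assumes nz: "\<And>k. 1 \<le> k \<Longrightarrow> k \<le> N \<Longrightarrow> hankel_det M k \<noteq> 0"
  defines "G \<equiv> Matrix.mat N N (\<lambda>(a, b). \<Sum>k<N.
    Polynomial.coeff (orth_poly M k) a * Polynomial.coeff (orth_poly M k) b / orth_norm M k)"
  shows "G * hankel_mat M N = 1\<^sub>m N"
proof -
  let ?P = "orth_poly M"
  have deg: "degree (?P j) = j" and lc: "lead_coeff (?P j) = 1" if "j < N" for j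
    using orth_poly_props[of N j, OF nz] that by auto
  have orth: "poly_inner M (?P i) (?P j) = 0" if "i < N" "j < N" "i \<noteq> j" for i j
    using orth_poly_props[of N i, OF nz] orth_poly_props[of N j, OF nz] that
      poly_inner_commute[of M "?P i" "?P j"]
    by (cases i j rule: linorder_cases) simp_all
  have "(\<Prod>j<N. poly_inner M (?P j) (?P j)) \<noteq> 0"
    using hankel_det_eq_prod[of N ?P, OF deg lc orth] nz[of N] by (cases "N = 0") auto
  hence h: "orth_norm M j \<noteq> 0" if "j < N" for j
    using that by (auto simp: orth_norm_def)
  let ?C = "coeff_mat N ?P" and ?H = "hankel_mat M N"
  \<comment> \<open>\<open>E\<close> is the transpose of \<open>?C\<close> with column
    \<open>k\<close> divided by the norm of \<open>?P k\<close>. It is a right inverse of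
    \<open>?C * ?H\<close>, hence a left inverse as the matrices are square, and
    \<open>E * ?C\<close> is \<open>G\<close>.\<close>
  define E where "E = Matrix.mat N N (\<lambda>(a, k). Polynomial.coeff (?P k) a / orth_norm M k)"
  have C: "?C \<in> carrier_mat N N" and H: "?H \<in> carrier_mat N N" and E: "E \<in> carrier_mat N N"
    by (auto simp: coeff_mat_def hankel_mat_def E_def)
  have CH: "?C * ?H \<in> carrier_mat N N" using C H by auto
  have "(?C * ?H) * E = 1\<^sub>m N"
  proof (rule eq_matI)
    fix i j assume "i < dim_row (1\<^sub>m N :: real Matrix.mat)" "j < dim_col (1\<^sub>m N :: real Matrix.mat)"
    hence i: "i < N" and j: "j < N" by simp_all
    have "((?C * ?H) * E) $$ (i, j) = (?C * ?H * transpose_mat ?C) $$ (i, j) / orth_norm M j"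
      using i j C H by (simp add: E_def scalar_prod_def sum_divide_distrib coeff_mat_def)
    also have "\<dots> = poly_inner M (?P i) (?P j) / orth_norm M j"
      using i j deg by (subst hankel_congruence) auto
    also have "\<dots> = 1\<^sub>m N $$ (i, j)"
      using i j orth[of i j] h[of j] by (auto simp: orth_norm_def)
    finally show "((?C * ?H) * E) $$ (i, j) = 1\<^sub>m N $$ (i, j)" .
  qed (use C E in auto)
  from mat_mult_left_right_inverse[OF CH E this] have "E * ?C * ?H = 1\<^sub>m N"
    using assoc_mult_mat[OF E C H] by simp
  moreover have "G = E * ?C"
    by (rule eq_matI) (auto simp: G_def E_def coeff_mat_def scalar_prod_def atLeast0LessThan)
  ultimately show ?thesis by simp
qed

end

section \<open>Evaluation of the bordered determinant\<close>

theorem proposition1p13: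
  fixes M :: "real measure"
    and n m :: nat
    and A :: "'a::real_field Matrix.mat"
    and x y :: "nat \<Rightarrow> 'a"
  assumes "1 \<le> m" and "m < n"
    and "sets M = sets borel"
    and "\<And>k. integrable M (\<lambda>t. t ^ k)"
    and "\<And>k. 1 \<le> k \<Longrightarrow> k \<le> n - m \<Longrightarrow> hankel_det M k \<noteq> 0"
    and "A \<in> carrier_mat m m"
  shows "bordered_hankel_det M n m x y A =
    of_real (hankel_det M (n - m)) *
      Determinant.det (A - Matrix.mat m m (\<lambda>(j, k). repr_kernel M (n - m - 1) (x k) (y j)))"
proof -
  define N where "N = n - m"
  let ?P = "orth_poly M"
  define G where "G = Matrix.mat N N (\<lambda>(a, b). \<Sum>k<N.
    Polynomial.coeff (?P k) a * Polynomial.coeff (?P k) b / orth_norm M k)"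
  let ?G = "map_mat of_real G :: 'a Matrix.mat"
  let ?H = "map_mat of_real (hankel_mat M N) :: 'a Matrix.mat"
  let ?X = "Matrix.mat N m (\<lambda>(i, k). x k ^ i)" and ?Y = "Matrix.mat m N (\<lambda>(j, i). y j ^ i)"
  have G: "G \<in> carrier_mat N N" and H: "hankel_mat M N \<in> carrier_mat N N"
    by (auto simp: G_def hankel_mat_def)
  have "G * hankel_mat M N = 1\<^sub>m N"
    unfolding G_def using assms(4,5) by (intro hankel_inverse) (auto simp: N_def)
  hence GH: "?G * ?H = 1\<^sub>m N"
    by (simp add: of_real_hom.mat_hom_mult[OF G H, symmetric] of_real_hom.mat_hom_one)
  have deg: "degree (?P k) < N" if "k < N" for k
    using orth_poly_props[of M N k] assms(4,5) that by (auto simp: N_def)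
  have eval: "poly (map_poly of_real (?P k)) z = (\<Sum>i<N. of_real (Polynomial.coeff (?P k) i) * z ^ i)"
    if "k < N" for k and z :: 'a
    using deg[OF that] by (subst poly_eq_sum_lessThan[of _ N]) (simp_all add: degree_map_poly coeff_map_poly)
  \<comment> \<open>\<open>?G\<close> holds the kernel's coefficients, and the powers in
    \<open>?X\<close> and \<open>?Y\<close> evaluate it at the given points.\<close>
  have "?Y * ?G * ?X = Matrix.mat m m (\<lambda>(j, k). repr_kernel M (N - 1) (x k) (y j))" (is "?l = ?r")
  proof (rule eq_matI)
    fix j l assume "j < dim_row ?r" "l < dim_col ?r"
    hence j: "j < m" and l: "l < m" by simp_all
    let ?c = "\<lambda>k i. of_real (Polynomial.coeff (?P k) i) :: 'a"
    have "?l $$ (j, l) = (\<Sum>b<N. (\<Sum>a<N. y j ^ a *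
        (\<Sum>k<N. ?c k a * ?c k b / of_real (orth_norm M k))) * x l ^ b)"
      using j l by (simp add: G_def scalar_prod_def atLeast0LessThan)
    also have "\<dots> = (\<Sum>b<N. \<Sum>a<N. \<Sum>k<N. (?c k b * x l ^ b) * (?c k a * y j ^ a) / of_real (orth_norm M k))"
      by (simp add: sum_distrib_left sum_distrib_right mult_ac)
    \<comment> \<open>Two swaps move the sum over \<open>k\<close> outside; the sums over
      \<open>a\<close> and \<open>b\<close> then factor into two polynomial values.\<close>
    also have "\<dots> = (\<Sum>b<N. \<Sum>k<N. \<Sum>a<N. (?c k b * x l ^ b) * (?c k a * y j ^ a) / of_real (orth_norm M k))"
      by (intro sum.cong refl sum.swap)
    also have "\<dots> = (\<Sum>k<N. \<Sum>b<N. \<Sum>a<N. (?c k b * x l ^ b) * (?c k a * y j ^ a) / of_real (orth_norm M k))"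
      by (rule sum.swap)
    also have "\<dots> = (\<Sum>k<N. poly (map_poly of_real (?P k)) (x l) * poly (map_poly of_real (?P k)) (y j)
        / of_real (orth_norm M k))"
      by (simp add: eval sum_product sum_divide_distrib)
    also have "\<dots> = repr_kernel M (N - 1) (x l) (y j)"
    proof -
      \<comment> \<open>Since \<open>m < n\<close>, \<open>N\<close> is positive and the natural
        subtraction \<open>N - 1\<close> does not truncate.\<close>
      have "{..N - 1} = {..<N}" using assms(2) by (auto simp: N_def)
      then show ?thesis unfolding repr_kernel_def by simp
    qed
    finally show "?l $$ (j, l) = ?r $$ (j, l)" using j l by simp
  qed auto
  moreover have "bordered_hankel_det M n m x y A
      = Determinant.det ?H * Determinant.det (A - ?Y * ?G * ?X)"
    unfolding bordered_hankel_det_def bordered_hankel_mat_def N_def[symmetric]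
    using G H GH assms(6) by (intro det_four_block_schur) auto
  ultimately show ?thesis
    by (simp add: hankel_det_def N_def)
qed

end
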